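(* Let $k\geq 3$ be an odd integer and let $n\geq 5$ be an integer. Then $smp^{k}(A_{n,2})=2n-4$.
   Context: The arrangement graph $A_{n,2}$ has as vertices all ordered pairs $[a_1,a_2]$ of distinct elements of $\{1,\dots,n\}$, two vertices being adjacent iff they differ in exactly one position; it is $2(n-2)$-regular. An integer $k$-matching of $G$ is a function $h:E(G)\to\{0,1,\dots,k\}$ with $\sum_{e\in\Gamma(v)}h(e)\leq k$ for all $v$ ($\Gamma(v)$ the edges incident with $v$); it is perfect if every vertex has sum $k$, and almost perfect if exactly one vertex has sum $k-1$ and all others have sum $k$. For $F\subseteq V(G)\cup E(G)$, $G-F$ is obtained by deleting the vertices of $F$ (with incident edges) and the edges of $F$. $smp^{k}(G)$ is the minimum size of $F\subseteq V(G)\cup E(G)$ such that $G-F$ has neither a perfect nor an almost perfect integer $k$-matching. *)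

theory Defs
  imports Main
begin

(* Simple graphs are given by a vertex set V and an edge set E of 2-element vertex sets. *)

definition arr_verts :: "nat \<Rightarrow> (nat \<times> nat) set" where
  "arr_verts n = {(a, b). a \<in> {1..n} \<and> b \<in> {1..n} \<and> a \<noteq> b}"

definition arr_edges :: "nat \<Rightarrow> (nat \<times> nat) set set" where
  "arr_edges n = {{u, v} | u v. u \<in> arr_verts n \<and> v \<in> arr_verts n \<and>
      ((fst u = fst v \<and> snd u \<noteq> snd v) \<or> (fst u \<noteq> fst v \<and> snd u = snd v))}"

definition incident :: "'a set set \<Rightarrow> 'a \<Rightarrow> 'a set set" where
  "incident E v = {e \<in> E. v \<in> e}"

definition int_matching :: "nat \<Rightarrow> 'a set \<Rightarrow> 'a set set \<Rightarrow> ('a set \<Rightarrow> nat) \<Rightarrow> bool" where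
  "int_matching k V E h \<longleftrightarrow> (\<forall>e\<in>E. h e \<le> k) \<and> (\<forall>v\<in>V. (\<Sum>e\<in>incident E v. h e) \<le> k)"

definition perfect_int_matching :: "nat \<Rightarrow> 'a set \<Rightarrow> 'a set set \<Rightarrow> ('a set \<Rightarrow> nat) \<Rightarrow> bool" where
  "perfect_int_matching k V E h \<longleftrightarrow> int_matching k V E h \<and>
     (\<forall>v\<in>V. (\<Sum>e\<in>incident E v. h e) = k)"

definition almost_perfect_int_matching :: "nat \<Rightarrow> 'a set \<Rightarrow> 'a set set \<Rightarrow> ('a set \<Rightarrow> nat) \<Rightarrow> bool" where
  "almost_perfect_int_matching k V E h \<longleftrightarrow> int_matching k V E h \<and>
     (\<exists>u\<in>V. (\<Sum>e\<in>incident E u. h e) = k - 1 \<and>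
        (\<forall>v\<in>V - {u}. (\<Sum>e\<in>incident E v. h e) = k))"

definition del_edges :: "'a set set \<Rightarrow> 'a set \<Rightarrow> 'a set set \<Rightarrow> 'a set set" where
  "del_edges E FV FE = {e \<in> E - FE. e \<inter> FV = {}}"

definition smp :: "nat \<Rightarrow> 'a set \<Rightarrow> 'a set set \<Rightarrow> nat" where
  "smp k V E = (LEAST m. \<exists>FV FE. FV \<subseteq> V \<and> FE \<subseteq> E \<and> m = card FV + card FE \<and>
      \<not> (\<exists>h. perfect_int_matching k (V - FV) (del_edges E FV FE) h) \<and>
      \<not> (\<exists>h. almost_perfect_int_matching k (V - FV) (del_edges E FV FE) h))"

end

theory Submission
  imports Defs
begin

text \<open>Deleting the \<open>2n - 4\<close> neighbours of a vertex isolates it. Conversely, let fewer faults be given.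
  In \<open>A_{n,2}\<close> every vertex lies in only two maximal cliques, its row and its column, so restoring one
  fault merges at most two parts of the remaining graph; since two parts cost at least \<open>2n - 4\<close>
  faults, \<open>q\<close> parts cost at least \<open>2n - 6 + q\<close>. By Tutte--Berge the faulty graph then has a matching
  that misses at most one vertex. If it misses none, scale it by \<open>k\<close>. If it misses one, grow
  an alternating tree from the missed vertex. A tree without edges between outer vertices would be
  another cheap multiway cut, so there are adjacent \<open>x\<close>, \<open>y\<close> and matchings
  \<open>M\<close>, \<open>N\<close> missing exactly \<open>x\<close> and exactly \<open>y\<close>; then
  \<open>(k+1)/2 M + (k-1)/2 N + (k-1)/2 {x,y}\<close> is almost perfect.\<close>

section \<open>Maximum matchings\<close>

definition matching :: "'a set set \<Rightarrow> 'a set set \<Rightarrow> bool" where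
  "matching E M \<longleftrightarrow> M \<subseteq> E \<and> pairwise disjnt M"

definition max_matching :: "'a set set \<Rightarrow> 'a set set \<Rightarrow> bool" where
  "max_matching E M \<longleftrightarrow> matching E M \<and> (\<forall>N. matching E N \<longrightarrow> card N \<le> card M)"

lemma matching_unique:
  assumes "matching E M" "e \<in> M" "f \<in> M" "x \<in> e" "x \<in> f"
  shows "e = f"
  using assms unfolding matching_def pairwise_def disjnt_iff by metis

lemma matching_mono: "matching E M \<Longrightarrow> E \<subseteq> E' \<Longrightarrow> matching E' M"
  unfolding matching_def by blast

lemma matching_insert:
  assumes "matching E M" "e \<in> E" "e \<inter> \<Union>M = {}"
  shows "matching E (insert e M)"
  using assms unfolding matching_def pairwise_insert disjnt_def by blast

lemma matching_subset: "matching E M \<Longrightarrow> N \<subseteq> M \<Longrightarrow> matching E N"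
  unfolding matching_def by (meson pairwise_subset subset_trans)

text \<open>All other edges of \<open>M\<close> avoid \<open>y\<close> and \<open>z\<close>, so
  \<open>{x, y}\<close> can replace \<open>{y, z}\<close>; the uncovered vertex \<open>x\<close> is
  traded for \<open>z\<close>. Both Gallai's argument and the growth of alternating trees use this
  exchange.\<close>

lemma matching_exchange:
  assumes M: "matching E M" and xy: "{x, y} \<in> E" and yz: "{y, z} \<in> M"
    and x: "x \<notin> \<Union>M" and "y \<noteq> z"
  shows "matching E (insert {x, y} (M - {{y, z}}))"
    and "\<Union>(insert {x, y} (M - {{y, z}})) = insert x (\<Union>M - {z})"
proof -
  have other: "y \<notin> f \<and> z \<notin> f" if "f \<in> M - {{y, z}}" for f
    using matching_unique[OF M _ yz] that by blast
  show "matching E (insert {x, y} (M - {{y, z}}))"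
  proof (rule matching_insert)
    show "matching E (M - {{y, z}})" using M by (rule matching_subset) blast
    show "{x, y} \<inter> \<Union>(M - {{y, z}}) = {}" using other x by blast
  qed (rule xy)
  show "\<Union>(insert {x, y} (M - {{y, z}})) = insert x (\<Union>M - {z})"
    using other yz x \<open>y \<noteq> z\<close> by blast
qed

locale fin_graph =
  fixes X :: "'a set" and E :: "'a set set"
  assumes fin: "finite X" and edge: "e \<in> E \<Longrightarrow> e \<subseteq> X \<and> card e = 2"
begin

lemma finite_edges: "finite E"
  by (rule finite_subset[of _ "Pow X"]) (use edge fin in auto)

lemma edge_other:
  assumes "e \<in> E" "x \<in> e"
  obtains y where "e = {x, y}" "y \<noteq> x" "y \<in> X" "x \<in> X"
proof -
  have "card e = 2" "e \<subseteq> X" using edge[OF assms(1)] by auto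
  then obtain a b where ab: "e = {a, b}" "a \<noteq> b" by (meson card_2_iff)
  show thesis
  proof (cases "x = a")
    case True then show thesis using ab that[of b] \<open>e \<subseteq> X\<close> by auto
  next
    case False
    then have "x = b" using ab assms(2) by auto
    then show thesis using ab that[of a] \<open>e \<subseteq> X\<close> by auto
  qed
qed

lemma finite_matching: "matching E M \<Longrightarrow> finite M"
  unfolding matching_def using finite_edges finite_subset by blast

lemma Union_matching: "matching E M \<Longrightarrow> \<Union>M \<subseteq> X"
  unfolding matching_def using edge by blast

lemma card_Union_matching:
  assumes "matching E M" shows "card (\<Union>M) = 2 * card M"
proof -
  have "card (\<Union>M) = sum card M"
    using assms edge card_ge_0_finite unfolding matching_def
    by (intro card_Union_disjoint) (auto, fastforce)
  also have "\<dots> = sum (\<lambda>_. 2) M"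
    using assms edge unfolding matching_def by (intro sum.cong) auto
  finally show ?thesis by simp
qed

lemma card_missed:
  assumes "matching E M" shows "card (X - \<Union>M) + 2 * card M = card X"
  using card_Diff_subset[of "\<Union>M" X] card_mono[OF fin Union_matching[OF assms]]
    card_Union_matching[OF assms] Union_matching[OF assms] fin finite_subset by fastforce

lemma ex_max_matching: "\<exists>M. max_matching E M"
proof -
  have "matching E {}" unfolding matching_def by simp
  moreover have "\<forall>M. matching E M \<longrightarrow> card M < Suc (card E)"
    unfolding matching_def using finite_edges by (simp add: card_mono le_imp_less_Suc)
  ultimately show ?thesis
    unfolding max_matching_def using ex_has_greatest_nat[of "matching E" _ card "Suc (card E)"] by blast
qed

text \<open>Otherwise \<open>{x, y}\<close> could be added to \<open>M\<close>. Hence the vertices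
  missed by a maximum matching are independent.\<close>

lemma max_matching_edge:
  assumes M: "max_matching E M" and e: "{x, y} \<in> E" and x: "x \<notin> \<Union>M"
  shows "y \<in> \<Union>M"
proof (rule ccontr)
  assume "y \<notin> \<Union>M"
  with x have "{x, y} \<inter> \<Union>M = {}" by blast
  moreover have m: "matching E M" using M unfolding max_matching_def by blast
  ultimately have "matching E (insert {x, y} M)" using e by (intro matching_insert)
  moreover have "card (insert {x, y} M) = Suc (card M)"
    using x finite_matching[OF m] by (intro card_insert_disjoint) auto
  ultimately show False using M unfolding max_matching_def by fastforce
qed

text \<open>The exchange argument of Gallai's lemma, with transitivity of the relation ``no maximum matching
  misses both'' taking the place of the usual induction on distances.\<close>

lemma Gallai_trans:
  assumes iness: "\<And>x. x \<in> X \<Longrightarrow> \<exists>M. max_matching E M \<and> x \<notin> \<Union>M"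
    and t: "t \<in> X" and X: "u \<in> X" "v \<in> X" and "u \<noteq> v"
    and ut: "\<And>M. max_matching E M \<Longrightarrow> u \<in> \<Union>M \<or> t \<in> \<Union>M"
    and tv: "\<And>M. max_matching E M \<Longrightarrow> t \<in> \<Union>M \<or> v \<in> \<Union>M"
    and M: "max_matching E M"
  shows "u \<in> \<Union>M \<or> v \<in> \<Union>M"
proof (rule ccontr)
  assume "\<not> ?thesis"
  then have uM: "u \<notin> \<Union>M" and vM: "v \<notin> \<Union>M" by auto
  have mM: "matching E M" using M unfolding max_matching_def by blast
  \<comment> \<open>Among the maximum matchings that miss \<open>t\<close>, one sharing the most
    edges with \<open>M\<close> is taken; an exchange that increases the overlap will contradict
    this choice.\<close>
  define P where "P N \<longleftrightarrow> max_matching E N \<and> t \<notin> \<Union>N" for N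
  have "\<exists>N. P N" unfolding P_def using iness[OF t] .
  moreover have "\<forall>N. P N \<longrightarrow> card (M \<inter> N) < Suc (card M)"
    using finite_matching[OF mM] by (simp add: card_mono le_imp_less_Suc)
  ultimately obtain N where N: "P N" "\<And>N'. P N' \<Longrightarrow> card (M \<inter> N') \<le> card (M \<inter> N)"
    using ex_has_greatest_nat[of P _ "\<lambda>N. card (M \<inter> N)"] by blast
  have mmN: "max_matching E N" and mN: "matching E N" and tN: "t \<notin> \<Union>N"
    using N(1) unfolding P_def max_matching_def by auto
  have uN: "u \<in> \<Union>N" and vN: "v \<in> \<Union>N" using ut[OF mmN] tv[OF mmN] tN by auto
  have eq: "card M = card N" using M mmN unfolding max_matching_def by (meson le_antisym)
  have "card (\<Union>M) = card (\<Union>N)" using card_Union_matching mM mN eq by simp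
  moreover have fM: "finite (\<Union>M)" and fN: "finite (\<Union>N)"
    using Union_matching mM mN fin finite_subset by blast+
  ultimately have "card (\<Union>M - \<Union>N) = card (\<Union>N - \<Union>M)"
    using card_Diff_subset_Int[of "\<Union>M" "\<Union>N"] card_Diff_subset_Int[of "\<Union>N" "\<Union>M"]
    by (simp add: Int_commute)
  \<comment> \<open>\<open>N\<close> covers \<open>u\<close> and \<open>v\<close>, which
    \<open>M\<close> misses. As both matchings cover equally many vertices, at least two vertices
    are covered by \<open>M\<close> alone, and one of them differs from \<open>t\<close>.\<close>
  moreover have "card {u, v} \<le> card (\<Union>N - \<Union>M)"
    using uM vM uN vN fN by (intro card_mono) auto
  ultimately have "\<not> \<Union>M - \<Union>N \<subseteq> {t}"
    using \<open>u \<noteq> v\<close> card_mono[of "{t}" "\<Union>M - \<Union>N"] by auto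
  then obtain x where x: "x \<in> \<Union>M" "x \<notin> \<Union>N" "x \<noteq> t" by blast
  then obtain e where "e \<in> M" "x \<in> e" by blast
  moreover from this have "e \<in> E" using mM unfolding matching_def by blast
  ultimately obtain y where xy: "{x, y} \<in> M" "{x, y} \<in> E" "y \<noteq> x" by (metis edge_other)
  have "y \<in> \<Union>N" using max_matching_edge[OF mmN xy(2) x(2)] .
  then obtain f where f: "f \<in> N" "y \<in> f" by blast
  moreover from this have "f \<in> E" using mN unfolding matching_def by blast
  ultimately obtain z where yz: "{y, z} \<in> N" "z \<noteq> y" by (metis edge_other)
  \<comment> \<open>Replacing the edge of \<open>N\<close> at \<open>y\<close> by the edge
    \<open>{x, y}\<close> of \<open>M\<close> keeps the size and still misses \<open>t\<close>, but
    raises the overlap with \<open>M\<close> by one.\<close>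
  let ?N = "insert {x, y} (N - {{y, z}})"
  note ex = matching_exchange[OF mN xy(2) yz(1) x(2) yz(2)[symmetric]]
  have xyN: "{x, y} \<notin> N" using x(2) by blast
  have "card ?N = card N"
    using finite_matching[OF mN] yz(1) xyN by (simp add: card_Suc_Diff1 del: card_Diff_insert)
  then have "max_matching E ?N" using ex(1) mmN unfolding max_matching_def by simp
  moreover have "t \<notin> \<Union>?N" unfolding ex(2) using tN x(3) by blast
  ultimately have "P ?N" unfolding P_def by blast
  \<comment> \<open>\<open>M\<close> covers \<open>y\<close> by \<open>{x, y}\<close>, and
    \<open>z\<close> differs from \<open>x\<close> because \<open>N\<close> misses \<open>x\<close>;
    so no common edge is lost.\<close>
  moreover have "{y, z} \<notin> M"
    using matching_unique[OF mM xy(1), of "{y, z}" y] x(2) yz(1) by auto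
  then have "M \<inter> ?N = insert {x, y} (M \<inter> N)" using xy(1) by blast
  then have "card (M \<inter> ?N) = Suc (card (M \<inter> N))"
    using xyN finite_matching[OF mM] by simp
  ultimately show False using N(2)[of ?N] by simp
qed

end

section \<open>Barriers and alternating trees\<close>

lemma fin_graph_del:
  assumes "fin_graph X E" shows "fin_graph (X - S) {e \<in> E. e \<inter> S = {}}"
  using assms unfolding fin_graph_def by blast

text \<open>One half of the Tutte--Berge formula, with colour classes in place of components. The barrier is a
  largest set of vertices whose deletion costs one matching edge each.\<close>

lemma Tutte_Berge_barrier:
  assumes G: "fin_graph X E" and M: "max_matching E M"
  shows "\<exists>S (c :: 'a \<Rightarrow> 'a set). S \<subseteq> X
    \<and> (\<forall>x y. {x, y} \<in> E \<and> x \<notin> S \<and> y \<notin> S \<longrightarrow> c x = c y)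
    \<and> card X + card S \<le> card (c ` (X - S)) + 2 * card M"
proof -
  interpret fin_graph X E by fact
  \<comment> \<open>Deleting \<open>S\<close> lowers the matching number by at least
    \<open>card S\<close>.\<close>
  define P where "P S \<longleftrightarrow> S \<subseteq> X \<and>
    (\<forall>N. matching {e \<in> E. e \<inter> S = {}} N \<longrightarrow> card N + card S \<le> card M)" for S
  have "P {}" unfolding P_def using M unfolding max_matching_def by simp
  moreover have "\<forall>S. P S \<longrightarrow> card S < Suc (card X)"
    unfolding P_def using fin by (simp add: card_mono le_imp_less_Suc)
  ultimately obtain S where S: "P S" "\<And>S'. P S' \<Longrightarrow> card S' \<le> card S"
    using ex_has_greatest_nat[of P "{}" card] by blast
  let ?Y = "X - S" and ?E = "{e \<in> E. e \<inter> S = {}}"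
  interpret Y: fin_graph ?Y ?E by (rule fin_graph_del[OF G])
  have SX: "S \<subseteq> X" and finS: "finite S" using S(1) fin finite_subset unfolding P_def by blast+
  obtain N0 where N0: "max_matching ?E N0" using Y.ex_max_matching by blast
  have N0S: "card N0 + card S \<le> card M" using S(1) N0 unfolding P_def max_matching_def by blast
  \<comment> \<open>As \<open>insert x S\<close> violates \<open>P\<close>, some matching avoiding
    \<open>S\<close> and \<open>x\<close> has at least \<open>card M - card S\<close> edges, hence
    is maximum in the graph without \<open>S\<close>.\<close>
  have iness: "\<exists>N. max_matching ?E N \<and> x \<notin> \<Union>N" if x: "x \<in> ?Y" for x
  proof -
    have "\<not> P (insert x S)" using S(2)[of "insert x S"] x finS by auto
    then obtain N where N: "matching {e \<in> E. e \<inter> insert x S = {}} N"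
      "card M < card N + Suc (card S)"
      unfolding P_def using x SX finS by auto
    have "matching ?E N" using N(1) by (rule matching_mono) blast
    moreover have "card N0 \<le> card N" using N(2) N0S by simp
    ultimately have "max_matching ?E N" using N0 unfolding max_matching_def by (meson le_trans)
    moreover have "x \<notin> \<Union>N" using N(1) unfolding matching_def by blast
    ultimately show ?thesis by blast
  qed
  \<comment> \<open>\<open>R\<close> relates vertices that no maximum matching misses together. By
    Gallai's argument it is transitive, so colouring each vertex by its own class is
    consistent.\<close>
  define R where "R x y \<longleftrightarrow> x = y \<or> (\<forall>N. max_matching ?E N \<longrightarrow> x \<in> \<Union>N \<or> y \<in> \<Union>N)" for x y
  define c where "c x = {y \<in> ?Y. R x y}" for x
  have sym: "R x y \<Longrightarrow> R y x" for x y unfolding R_def by blast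
  have trans: "R x z" if "x \<in> ?Y" "y \<in> ?Y" "z \<in> ?Y" "R x y" "R y z" for x y z
  proof (cases "x = z \<or> x = y \<or> y = z")
    case True then show ?thesis using that unfolding R_def by blast
  next
    case False
    then have xy: "x \<in> \<Union>N \<or> y \<in> \<Union>N" and yz: "y \<in> \<Union>N \<or> z \<in> \<Union>N"
      if "max_matching ?E N" for N
      using \<open>R x y\<close> \<open>R y z\<close> that unfolding R_def by blast+
    show ?thesis unfolding R_def
      using Y.Gallai_trans[OF iness \<open>y \<in> ?Y\<close> \<open>x \<in> ?Y\<close> \<open>z \<in> ?Y\<close> _ xy yz] False by blast
  qed
  have mono: "c x = c y" if "{x, y} \<in> E" "x \<notin> S" "y \<notin> S" for x y
  proof -
    have xy: "{x, y} \<in> ?E" using that by blast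
    then have Y: "x \<in> ?Y" "y \<in> ?Y" using Y.edge by blast+
    have "R x y" unfolding R_def using Y.max_matching_edge[OF _ xy] by blast
    then have "R x w \<longleftrightarrow> R y w" if "w \<in> ?Y" for w
      using trans[OF Y that] trans[OF Y(2,1) that] sym by blast
    then show ?thesis unfolding c_def by blast
  qed
  \<comment> \<open>A maximum matching misses at most one vertex of each class, so the number of
    classes bounds the number of missed vertices.\<close>
  have "inj_on c (?Y - \<Union>N0)"
  proof (rule inj_onI)
    fix x y assume "x \<in> ?Y - \<Union>N0" "y \<in> ?Y - \<Union>N0" "c x = c y"
    moreover from this have "y \<in> c y" unfolding c_def R_def by blast
    ultimately have "R x y" "x \<notin> \<Union>N0" "y \<notin> \<Union>N0" using c_def by auto
    then show "x = y" unfolding R_def using N0 by blast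
  qed
  then have "card (?Y - \<Union>N0) = card (c ` (?Y - \<Union>N0))" by (simp add: card_image)
  also have "\<dots> \<le> card (c ` ?Y)" by (intro card_mono finite_imageI Y.fin) auto
  finally have "card ?Y \<le> card (c ` ?Y) + 2 * card N0"
    using Y.card_missed[of N0] N0 unfolding max_matching_def by simp
  then have "card X + card S \<le> card (c ` ?Y) + 2 * card M"
    using N0S card_Diff_subset[OF finS SX] card_mono[OF fin SX] by simp
  then show ?thesis using SX mono by blast
qed

text \<open>\<open>D\<close> and \<open>A\<close> are the outer and inner vertices of a maximal alternating tree. Each outer vertex is
  missed by some near-perfect matching.\<close>

lemma alternating_tree:
  assumes G: "fin_graph X E" and M: "matching E M" "\<Union>M = X - {u}" and u: "u \<in> X"
    and indep: "\<And>x y N N'. {x, y} \<in> E \<Longrightarrow> matching E N \<Longrightarrow> \<Union>N = X - {x} \<Longrightarrow>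
      matching E N' \<Longrightarrow> \<Union>N' = X - {y} \<Longrightarrow> False"
  shows "\<exists>D A. D \<union> A \<subseteq> X \<and> D \<inter> A = {} \<and> card D = card A + 1
    \<and> (\<forall>x y. {x, y} \<in> E \<and> x \<in> D \<longrightarrow> y \<in> A)"
proof -
  interpret fin_graph X E by fact
  \<comment> \<open>The last condition keeps all edges of \<open>M\<close> disjoint from
    \<open>C\<close>, so that the tree can still be extended by them.\<close>
  define near where "near C d \<longleftrightarrow>
    (\<exists>N. matching E N \<and> \<Union>N = X - {d} \<and> {e \<in> M. e \<inter> C = {}} \<subseteq> N)" for C d
  \<comment> \<open>The tree is recorded by its vertex sets only; the matchings in
    \<open>near\<close> stand for its alternating paths. No edge of \<open>M\<close> leaves the
    tree.\<close>
  define P where "P D A \<longleftrightarrow> (D \<union> A \<subseteq> X \<and> D \<inter> A = {} \<and> card D = card A + 1 \<and> u \<in> D)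
    \<and> (\<forall>e\<in>M. e \<subseteq> D \<union> A \<or> e \<inter> (D \<union> A) = {}) \<and> (\<forall>d\<in>D. near (D \<union> A) d)" for D A
  have "near {u} u" unfolding near_def using M by (intro exI[of _ M]) simp
  moreover have "\<forall>e\<in>M. e \<subseteq> {u} \<or> e \<inter> {u} = {}" using M(2) by fast
  ultimately have "P {u} {}" unfolding P_def using u by simp
  then have "\<exists>A. P {u} A" ..
  moreover have "\<forall>D. (\<exists>A. P D A) \<longrightarrow> card D < Suc (card X)"
  proof (intro allI impI)
    fix D assume "\<exists>A. P D A"
    then have "D \<subseteq> X" unfolding P_def by simp
    then show "card D < Suc (card X)" using card_mono[OF fin] by (simp add: less_Suc_eq_le)
  qed
  ultimately obtain D A where DA: "P D A" "\<And>D' A'. P D' A' \<Longrightarrow> card D' \<le> card D"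
    using ex_has_greatest_nat[of "\<lambda>D. \<exists>A. P D A" "{u}" card] by metis
  let ?C = "D \<union> A"
  have DAX: "?C \<subseteq> X" and disj: "D \<inter> A = {}" and card: "card D = card A + 1" and uD: "u \<in> D"
    using DA(1)[unfolded P_def, THEN conjunct1] by simp_all
  have close: "e \<subseteq> ?C \<or> e \<inter> ?C = {}" if "e \<in> M" for e
    using DA(1)[unfolded P_def, THEN conjunct2, THEN conjunct1] that by (rule bspec)
  have near: "near ?C d" if "d \<in> D" for d
    using DA(1)[unfolded P_def, THEN conjunct2, THEN conjunct2] that by (rule bspec)
  have finDA: "finite D" "finite A" using finite_subset[OF DAX fin] by simp_all
  \<comment> \<open>A neighbour \<open>a\<close> of an outer vertex is not outer, by
    \<open>indep\<close>. If it were outside the tree, so would be its edge \<open>{a, b}\<close> of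
    \<open>M\<close>, and adding \<open>a\<close> to \<open>A\<close> and \<open>b\<close> to
    \<open>D\<close> would enlarge the tree.\<close>
  have "a \<in> A" if da: "{d, a} \<in> E" "d \<in> D" for d a
  proof (rule ccontr)
    assume "a \<notin> A"
    obtain N where N: "matching E N" "\<Union>N = X - {d}" "{e \<in> M. e \<inter> ?C = {}} \<subseteq> N"
      using near[OF da(2)] unfolding near_def by (elim exE conjE)
    have "a \<notin> D"
    proof
      assume "a \<in> D"
      obtain N' where "matching E N'" "\<Union>N' = X - {a}"
        using near[OF \<open>a \<in> D\<close>] unfolding near_def by (elim exE conjE)
      then show False by (rule indep[OF da(1) N(1,2)])
    qed
    then have "a \<in> \<Union>M" using M(2) uD edge[OF da(1)] by fastforce
    then obtain e where e: "e \<in> M" "a \<in> e" by (rule UnionE)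
    have "e \<in> E" using M(1) e(1) unfolding matching_def by blast
    then obtain b where b: "e = {a, b}" "b \<noteq> a" "b \<in> X" "a \<in> X" using e(2) by (rule edge_other)
    have out: "e \<inter> ?C = {}" using close[OF e(1)] e(2) \<open>a \<notin> D\<close> \<open>a \<notin> A\<close> by auto
    then have bC: "b \<notin> D" "b \<notin> A" using b(1) by simp_all
    have abN: "{a, b} \<in> N" using N(3) e(1) b(1) out by (simp add: subset_iff)
    have dN: "d \<notin> \<Union>N" unfolding N(2) by simp
    \<comment> \<open>This turns a matching missing \<open>d\<close> into one missing
      \<open>b\<close>.\<close>
    note ex = matching_exchange[OF N(1) da(1) abN dN b(2)[symmetric]]
    let ?D = "insert b D" and ?A = "insert a A"
    let ?C' = "?D \<union> ?A"
    have shrink: "{e \<in> M. e \<inter> ?C' = {}} \<subseteq> {e \<in> M. e \<inter> ?C = {}}" by auto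
    have "near ?C' d'" if "d' \<in> ?D" for d'
    proof (cases "d' \<in> D")
      case True
      then show ?thesis using near[OF True] shrink unfolding near_def by (meson subset_trans)
    next
      case False
      then have "d' = b" using that by simp
      have "d \<in> X" "d \<noteq> b" using da(2) DAX bC(1) by auto
      then have "insert d (\<Union>N - {b}) = X - {b}" unfolding N(2) by auto
      moreover have "{e \<in> M. e \<inter> ?C' = {}} \<subseteq> insert {d, a} (N - {{a, b}})"
        using subset_trans[OF shrink N(3)] by auto
      ultimately show ?thesis using ex unfolding \<open>d' = b\<close> near_def by (metis (no_types))
    qed
    moreover have "f \<subseteq> ?C' \<or> f \<inter> ?C' = {}" if f: "f \<in> M" for f
    proof (cases "f = e")
      case True then show ?thesis using b(1) by simp
    next
      case False
      then have "a \<notin> f" "b \<notin> f"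
        using matching_unique[OF M(1) f e(1), of a] matching_unique[OF M(1) f e(1), of b] b(1) by auto
      then show ?thesis using close[OF f] by auto
    qed
    moreover have "?C' \<subseteq> X" using DAX b(3,4) by simp
    moreover have "?D \<inter> ?A = {}" using disj b(2) bC \<open>a \<notin> D\<close> by simp
    moreover have "card ?D = card ?A + 1" using card finDA bC \<open>a \<notin> A\<close> by simp
    ultimately have "P ?D ?A" unfolding P_def using uD by (intro conjI ballI) (simp_all del: Un_insert_left Un_insert_right)
    then have "card ?D \<le> card D" by (rule DA(2))
    then show False using finDA bC by simp
  qed
  then have "\<forall>x y. {x, y} \<in> E \<and> x \<in> D \<longrightarrow> y \<in> A" by blast
  then show ?thesis using DAX disj card by (intro exI[of _ D] exI[of _ A] conjI)
qed

section \<open>Integer matchings from matchings\<close>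

text \<open>At most one edge of \<open>M\<close> contains \<open>v\<close>. Vertex sums of weighted
  combinations of matchings can thus be read off the covered sets.\<close>

lemma sum_incident_matching:
  assumes "finite E" "matching E M"
  shows "(\<Sum>e\<in>incident E v. if e \<in> M then c else 0) = (if v \<in> \<Union>M then c else (0::nat))"
proof (cases "v \<in> \<Union>M")
  case True
  then obtain f where f: "f \<in> M" "v \<in> f" by blast
  have "(if e \<in> M then c else 0) = (if e = f then c else 0)" if "e \<in> incident E v" for e
    using matching_unique[OF assms(2) _ f(1)] that f unfolding incident_def by auto
  then have "(\<Sum>e\<in>incident E v. if e \<in> M then c else 0) = (\<Sum>e\<in>incident E v. if e = f then c else 0)"
    by (rule sum.cong[OF refl])
  also have "\<dots> = c"
    using f assms unfolding incident_def matching_def by (subst sum.delta) auto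
  finally show ?thesis using True by simp
next
  case False
  then show ?thesis unfolding incident_def by (auto intro!: sum.neutral)
qed

text \<open>Each edge has an endpoint in \<open>X\<close>, and the sum there dominates the weight of
  the edge.\<close>

lemma (in fin_graph) int_matchingI:
  assumes "\<And>v. v \<in> X \<Longrightarrow> (\<Sum>e\<in>incident E v. h e) \<le> k"
  shows "int_matching k X E h"
proof -
  have "h e \<le> k" if e: "e \<in> E" for e
  proof -
    obtain v where v: "v \<in> e" "v \<in> X" using edge[OF e] by (metis card_2_iff' subsetD)
    have "h e \<le> (\<Sum>e\<in>incident E v. h e)"
      using finite_edges e v unfolding incident_def by (intro member_le_sum) auto
    then show ?thesis using assms[OF v(2)] by simp
  qed
  then show ?thesis using assms unfolding int_matching_def by blast
qed

lemma (in fin_graph) perfect_int_matching_if_perfect: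
  assumes "matching E M" "\<Union>M = X"
  shows "perfect_int_matching k X E (\<lambda>e. if e \<in> M then k else 0)"
proof -
  have "(\<Sum>e\<in>incident E v. if e \<in> M then k else 0) = k" if "v \<in> X" for v
    using sum_incident_matching[OF finite_edges assms(1)] that unfolding assms(2) by simp
  then show ?thesis unfolding perfect_int_matching_def by (simp add: int_matchingI)
qed

text \<open>For \<open>k = 2 * j + 1\<close> the matchings \<open>M\<close>, \<open>N\<close> and
  \<open>{x, y}\<close> get the weights \<open>j + 1\<close>, \<open>j\<close> and \<open>j\<close>.
  The sum is \<open>j + j = k - 1\<close> at \<open>x\<close>, where \<open>M\<close> is absent, and
  \<open>(j + 1) + j = k\<close> everywhere else.\<close>

lemma (in fin_graph) almost_perfect_int_matching_if_near_perfect: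
  assumes "odd k" and xy: "{x, y} \<in> E"
    and M: "matching E M" "\<Union>M = X - {x}" and N: "matching E N" "\<Union>N = X - {y}"
  shows "\<exists>h. almost_perfect_int_matching k X E h"
proof -
  obtain j where k: "k = 2 * j + 1" using assms(1) by (auto elim: oddE)
  have XY: "x \<in> X" "y \<in> X" "x \<noteq> y" using edge[OF xy] by (auto simp: card_insert_if split: if_splits)
  define h where "h e = (if e \<in> M then j + 1 else 0) + (if e \<in> N then j else 0)
    + (if e \<in> {{x, y}} then j else 0)" for e
  have "matching E {{x, y}}" unfolding matching_def using xy by auto
  then have h: "(\<Sum>e\<in>incident E v. h e) = (if v \<in> X - {x} then j + 1 else 0)
    + (if v \<in> X - {y} then j else 0) + (if v \<in> {x, y} then j else 0)" for v
    unfolding h_def sum.distrib sum_incident_matching[OF finite_edges M(1)]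
      sum_incident_matching[OF finite_edges N(1)] M(2) N(2)
    using sum_incident_matching[OF finite_edges, of "{{x, y}}"] by auto
  have "int_matching k X E h" by (rule int_matchingI) (auto simp: h k)
  moreover have "(\<Sum>e\<in>incident E x. h e) = k - 1" using XY by (auto simp: h k)
  moreover have "\<forall>v\<in>X - {x}. (\<Sum>e\<in>incident E v. h e) = k" using XY by (auto simp: h k)
  ultimately show ?thesis unfolding almost_perfect_int_matching_def using XY(1) by blast
qed

section \<open>Cuts of the arrangement graph\<close>

lemma arr_edge_iff:
  "{u, v} \<in> arr_edges n \<longleftrightarrow> u \<in> arr_verts n \<and> v \<in> arr_verts n \<and>
    (fst u = fst v \<and> snd u \<noteq> snd v \<or> fst u \<noteq> fst v \<and> snd u = snd v)"
  (is "?L \<longleftrightarrow> ?R")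
proof
  show "?L \<Longrightarrow> ?R" unfolding arr_edges_def by (auto simp: doubleton_eq_iff)
  show "?R \<Longrightarrow> ?L" unfolding arr_edges_def by blast
qed

lemma arr_edgeI:
  assumes "u \<in> arr_verts n" "v \<in> arr_verts n" "u \<noteq> v" "fst u = fst v \<or> snd u = snd v"
  shows "{u, v} \<in> arr_edges n"
  using assms unfolding arr_edge_iff by (simp add: prod_eq_iff) blast

lemma arr_edgeD:
  assumes "{u, v} \<in> arr_edges n"
  shows "u \<in> arr_verts n" "v \<in> arr_verts n" "u \<noteq> v"
  using assms unfolding arr_edge_iff by auto

lemma arr_edge_eq:
  assumes "e \<in> arr_edges n" "x \<in> e" "y \<in> e" "x \<noteq> y"
  shows "e = {x, y}"
  using assms unfolding arr_edges_def by auto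

lemma arr_verts_iff: "(i, j) \<in> arr_verts n \<longleftrightarrow> i \<in> {1..n} \<and> j \<in> {1..n} \<and> i \<noteq> j"
  unfolding arr_verts_def by simp

lemma arr_verts_Sigma: "arr_verts n = (SIGMA i:{1..n}. {1..n} - {i})"
  unfolding arr_verts_def by auto

lemma finite_arr_verts: "finite (arr_verts n)"
  unfolding arr_verts_Sigma by simp

lemma card_arr_verts: "card (arr_verts n) = n * (n - 1)"
  unfolding arr_verts_Sigma by simp

lemma fin_graph_arr: "fin_graph (arr_verts n) (arr_edges n)"
proof
  fix e assume "e \<in> arr_edges n"
  then show "e \<subseteq> arr_verts n \<and> card e = 2"
    unfolding arr_edges_def by (auto simp: card_insert_if)
qed (rule finite_arr_verts)

lemma finite_arr_edges: "finite (arr_edges n)"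
  by (rule fin_graph.finite_edges[OF fin_graph_arr])

text \<open>This counts the other vertices in the row, or in the column, of \<open>(i, j)\<close>,
  and also the columns in which rows \<open>i\<close> and \<open>j\<close> both have a
  vertex.\<close>

lemma card_line:
  assumes "i \<in> {1..n}" "j \<in> {1..n}" "i \<noteq> (j::nat)"
  shows "card ({1..n} - {i, j}) = n - 2"
  using assms by (subst card_Diff_subset) auto

lemma card_arr_nbrs:
  assumes "v \<in> arr_verts n"
  shows "card {w. {v, w} \<in> arr_edges n} = 2 * n - 4"
proof -
  obtain i j where v: "v = (i, j)" by (cases v)
  then have ij: "i \<in> {1..n}" "j \<in> {1..n}" "i \<noteq> j" using assms arr_verts_iff by auto
  let ?L = "{1..n} - {i, j}"
  have "{w. {v, w} \<in> arr_edges n} = {i} \<times> ?L \<union> ?L \<times> {j}"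
    using ij by (auto simp: v arr_edge_iff arr_verts_iff)
  moreover have "({i} \<times> ?L) \<inter> (?L \<times> {j}) = {}" by blast
  ultimately show ?thesis
    using card_line[OF ij] by (simp add: card_Un_disjoint card_cartesian_product)
qed

section \<open>Cuts into two parts\<close>

text \<open>If \<open>A\<close> is a single vertex, \<open>T\<close> contains all its neighbours.
  Otherwise two vertices of \<open>A\<close> lie in different columns, and the \<open>n - 2\<close>
  other vertices of each of these columns are outside row \<open>i\<close>, hence in
  \<open>T\<close>.\<close>

lemma arr_cut_single_row:
  assumes A: "A \<subseteq> arr_verts n" "A \<noteq> {}" "fst ` A \<subseteq> {i}"
    and T: "finite T" "\<And>a w. a \<in> A \<Longrightarrow> {a, w} \<in> arr_edges n \<Longrightarrow> w \<in> A \<union> T"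
  shows "2 * n - 4 \<le> card T"
proof -
  obtain j where j: "(i, j) \<in> A" using A(2,3) by fastforce
  then have ij: "i \<in> {1..n}" "j \<in> {1..n}" "i \<noteq> j" using A(1) arr_verts_iff by auto
  show ?thesis
  proof (cases "A = {(i, j)}")
    case True
    have "{w. {(i, j), w} \<in> arr_edges n} \<subseteq> T"
    proof clarify
      fix w assume "{(i, j), w} \<in> arr_edges n"
      then show "w \<in> T" using T(2)[OF j] arr_edgeD(3) True by blast
    qed
    then show ?thesis
      using card_mono[OF T(1)] card_arr_nbrs[of "(i, j)" n] j A(1) by (metis subsetD)
  next
    case False
    then obtain x where "x \<in> A" "x \<noteq> (i, j)" using j by blast
    then obtain j' where j': "(i, j') \<in> A" "j' \<noteq> j" using A(3) by (cases x) auto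
    then have ij': "i \<in> {1..n}" "j' \<in> {1..n}" "i \<noteq> j'" using A(1) arr_verts_iff by auto
    have col: "({1..n} - {i, c}) \<times> {c} \<subseteq> T" if c: "(i, c) \<in> A" for c
    proof
      fix p assume "p \<in> ({1..n} - {i, c}) \<times> {c}"
      then obtain r where r: "r \<in> {1..n}" "r \<noteq> i" "r \<noteq> c" and p: "p = (r, c)" by blast
      have "{(i, c), (r, c)} \<in> arr_edges n"
        using A(1) c r by (auto simp: arr_edge_iff arr_verts_iff)
      then have "(r, c) \<in> A \<union> T" by (rule T(2)[OF c])
      then show "p \<in> T" using A(3) r p by auto
    qed
    let ?C = "({1..n} - {i, j}) \<times> {j} \<union> ({1..n} - {i, j'}) \<times> {j'}"
    have "card ?C = card (({1..n} - {i, j}) \<times> {j}) + card (({1..n} - {i, j'}) \<times> {j'})"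
      using j'(2) by (intro card_Un_disjoint) auto
    then have "card ?C = 2 * (n - 2)"
      using card_line[OF ij] card_line[OF ij'] by (simp add: card_cartesian_product)
    moreover have "card ?C \<le> card T" using col[OF j] col[OF j'(1)] by (intro card_mono T(1)) blast
    ultimately show ?thesis by simp
  qed
qed

text \<open>Two rows that contain vertices of \<open>A\<close> and of \<open>B\<close> respectively are separated column by column.\<close>

lemma arr_cut_two_rows:
  assumes AB: "A \<subseteq> arr_verts n" "B \<subseteq> arr_verts n" "A \<inter> B = {}"
    and noedge: "\<And>a b. a \<in> A \<Longrightarrow> b \<in> B \<Longrightarrow> {a, b} \<notin> arr_edges n"
    and x: "x \<in> A" and y: "y \<in> B"
  shows "n - 2 \<le> card {t \<in> arr_verts n - (A \<union> B). fst t = fst x \<or> fst t = fst y}"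
proof -
  let ?i = "fst x" and ?i' = "fst y" and ?T = "arr_verts n - (A \<union> B)"
  have lineA: "w \<in> A \<union> ?T" if "w \<in> arr_verts n" "fst w = fst a \<or> snd w = snd a" "a \<in> A" for w a
    using noedge[OF that(3), of w] arr_edgeI[of a n w] that AB by (metis DiffI UnE UnI1 UnI2 disjoint_iff subsetD)
  have lineB: "w \<in> B \<union> ?T" if "w \<in> arr_verts n" "fst w = fst b" "b \<in> B" for w b
    using noedge[OF _ that(3), of w] arr_edgeI[of w n b] that AB by auto
  have xy: "x \<in> arr_verts n" "y \<in> arr_verts n" using x y AB by auto
  then have ii: "?i \<in> {1..n}" "?i' \<in> {1..n}" unfolding arr_verts_def by auto
  have ne: "?i \<noteq> ?i'" using lineB[of x y] x y xy AB(3) by blast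
  \<comment> \<open>In each column \<open>c\<close> met by both rows, \<open>f\<close> picks a
    vertex of \<open>?T\<close>. If \<open>(?i, c)\<close> is not in \<open>?T\<close>, it is in
    \<open>A\<close>, because its row meets \<open>A\<close>. Then \<open>(?i', c)\<close> is not in
    \<open>B\<close>, by its column, and not in \<open>A\<close>, by the row of
    \<open>y\<close>.\<close>
  define f where "f c = (if (?i, c) \<in> ?T then (?i, c) else (?i', c))" for c
  have "f c \<in> {t \<in> ?T. fst t = ?i \<or> fst t = ?i'}" if c: "c \<in> {1..n} - {?i, ?i'}" for c
  proof (cases "(?i, c) \<in> ?T")
    case True then show ?thesis by (simp add: f_def)
  next
    case False
    have V: "(?i, c) \<in> arr_verts n" "(?i', c) \<in> arr_verts n" using c ii by (auto simp: arr_verts_iff)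
    have "(?i, c) \<in> A" using lineA[OF V(1) _ x] False by auto
    then have "(?i', c) \<in> A \<union> ?T" using lineA[OF V(2), of "(?i, c)"] by simp
    moreover have "(?i', c) \<in> B \<union> ?T" using lineB[OF V(2) _ y] by simp
    ultimately have "(?i', c) \<in> ?T" using AB(3) by blast
    then show ?thesis using False by (simp add: f_def)
  qed
  moreover have "inj_on f ({1..n} - {?i, ?i'})" by (rule inj_onI) (auto simp: f_def split: if_splits)
  ultimately have "card ({1..n} - {?i, ?i'}) \<le> card {t \<in> ?T. fst t = ?i \<or> fst t = ?i'}"
    using finite_arr_verts by (intro card_inj_on_le[of f] image_subsetI) simp_all
  then show ?thesis using card_line[OF ii ne] by simp
qed

text \<open>Rows are cliques, so none meets both \<open>A\<close> and \<open>B\<close>. If each of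
  \<open>A\<close> and \<open>B\<close> meets two rows, these form two disjoint pairs of rows, and
  each pair contains \<open>n - 2\<close> vertices of the cut. Otherwise one side lies in a single
  row.\<close>

lemma arr_vertex_cut:
  assumes AB: "A \<subseteq> arr_verts n" "B \<subseteq> arr_verts n" "A \<inter> B = {}" "A \<noteq> {}" "B \<noteq> {}"
    and noedge: "\<And>a b. a \<in> A \<Longrightarrow> b \<in> B \<Longrightarrow> {a, b} \<notin> arr_edges n"
  shows "2 * n - 4 \<le> card (arr_verts n - (A \<union> B))"
proof -
  let ?T = "arr_verts n - (A \<union> B)"
  have finT: "finite ?T" using finite_arr_verts by simp
  obtain a b where ab: "a \<in> A" "b \<in> B" using AB by blast
  consider "fst ` A \<subseteq> {fst a}" | "fst ` B \<subseteq> {fst b}"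
    | a' b' where "a' \<in> A" "fst a' \<noteq> fst a" "b' \<in> B" "fst b' \<noteq> fst b" by blast
  then show ?thesis
  proof cases
    case 1
    then show ?thesis
    proof (rule arr_cut_single_row[OF AB(1,4) _ finT])
      fix x w assume "x \<in> A" "{x, w} \<in> arr_edges n"
      then show "w \<in> A \<union> ?T" using noedge arr_edgeD(2) by blast
    qed
  next
    case 2
    then show ?thesis
    proof (rule arr_cut_single_row[OF AB(2,5) _ finT])
      fix x w assume x: "x \<in> B" "{x, w} \<in> arr_edges n"
      then have "{w, x} \<in> arr_edges n" by (simp add: insert_commute)
      then show "w \<in> B \<union> ?T" using noedge[OF _ x(1), of w] arr_edgeD(1) by blast
    qed
  next
    case 3
    let ?R = "\<lambda>x y. {t \<in> ?T. fst t = fst x \<or> fst t = fst y}"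
    have rows: "n - 2 \<le> card (?R x y)" if "x \<in> A" "y \<in> B" for x y
      by (rule arr_cut_two_rows[OF AB(1-3) _ that]) (rule noedge)
    have sep: "fst x \<noteq> fst y" if "x \<in> A" "y \<in> B" for x y
      using noedge[OF that] arr_edgeI[of x n y] that AB(1-3) by blast
    have "?R a b \<inter> ?R a' b' = {}"
      using 3 ab sep[of a b'] sep[of a' b] by auto
    then have "card (?R a b) + card (?R a' b') = card (?R a b \<union> ?R a' b')"
      using finT by (intro card_Un_disjoint[symmetric] finite_subset[OF _ finT]) auto
    also have "\<dots> \<le> card ?T" by (intro card_mono finT) auto
    finally show ?thesis using rows[OF ab] rows[OF 3(1,3)] by linarith
  qed
qed

text \<open>Moving an endpoint \<open>a\<close> of a crossing edge from \<open>A\<close> to the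
  deleted vertices costs one vertex and saves at least one edge, so the total does not grow. This
  ends with a pure vertex cut, or with \<open>A = {a}\<close>, where every neighbour of
  \<open>a\<close> is deleted or ends a crossing edge.\<close>

lemma arr_mixed_cut:
  assumes "A \<subseteq> arr_verts n" "B \<subseteq> arr_verts n" "A \<inter> B = {}" "A \<noteq> {}" "B \<noteq> {}"
  shows "2 * n - 4 \<le> card (arr_verts n - (A \<union> B))
    + card {e \<in> arr_edges n. e \<inter> A \<noteq> {} \<and> e \<inter> B \<noteq> {}}"
  using assms
proof (induction "card A" arbitrary: A rule: less_induct)
  case less
  let ?cross = "\<lambda>A. {e \<in> arr_edges n. e \<inter> A \<noteq> {} \<and> e \<inter> B \<noteq> {}}"
  let ?T = "arr_verts n - (A \<union> B)"
  note AB = less.prems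
  have fin: "finite A" "finite ?T" "finite B" "finite (?cross A)"
    using AB finite_arr_verts finite_arr_edges finite_subset by (blast, simp, blast, simp)
  show ?case
  proof (cases "\<exists>a\<in>A. \<exists>b\<in>B. {a, b} \<in> arr_edges n")
    case False
    then have "2 * n - 4 \<le> card ?T" using AB by (intro arr_vertex_cut) auto
    then show ?thesis by simp
  next
    case True
    then obtain a b where ab: "a \<in> A" "b \<in> B" "{a, b} \<in> arr_edges n" by blast
    show ?thesis
    proof (cases "A = {a}")
      case True
      let ?N = "{w. {a, w} \<in> arr_edges n}"
      have "?N \<subseteq> ?T \<union> (?N \<inter> B)" using True by (auto simp: arr_edge_iff)
      then have "card ?N \<le> card (?T \<union> (?N \<inter> B))" using fin by (intro card_mono) auto
      also have "\<dots> \<le> card ?T + card (?N \<inter> B)" by (rule card_Un_le)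
      also have "card (?N \<inter> B) = card ((\<lambda>w. {a, w}) ` (?N \<inter> B))"
        by (intro card_image[symmetric] inj_onI) (auto simp: doubleton_eq_iff)
      also have "\<dots> \<le> card (?cross A)" using True fin by (intro card_mono) auto
      finally show ?thesis unfolding card_arr_nbrs[OF arr_edgeD(1)[OF ab(3)]] by simp
    next
      case False
      let ?A = "A - {a}"
      have "card ?A < card A" by (rule card_Diff1_less[OF fin(1) ab(1)])
      then have IH: "2 * n - 4 \<le> card (arr_verts n - (?A \<union> B)) + card (?cross ?A)"
        using AB False ab by (intro less.hyps) auto
      have "arr_verts n - (?A \<union> B) = insert a ?T" using ab AB by auto
      then have "card (arr_verts n - (?A \<union> B)) = Suc (card ?T)" using ab fin by simp
      moreover have "?cross ?A \<subset> ?cross A"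
      proof
        show "?cross ?A \<subseteq> ?cross A" by auto
        have "{a, b} \<in> ?cross A" using ab by auto
        moreover have "{a, b} \<notin> ?cross ?A" using ab AB by auto
        ultimately show "?cross ?A \<noteq> ?cross A" by metis
      qed
      then have "card (?cross ?A) < card (?cross A)" by (rule psubset_card_mono[OF fin(4)])
      ultimately show ?thesis using IH by linarith
    qed
  qed
qed

section \<open>Cuts into several parts\<close>

text \<open>With colour classes as the parts of a multiway cut, these are the edges to be deleted in
  addition to the vertices of \<open>T\<close>.\<close>

definition bichromatic :: "'a set set \<Rightarrow> 'a set \<Rightarrow> ('a \<Rightarrow> 'c) \<Rightarrow> 'a set set" where
  "bichromatic E T c = {{x, y} | x y. {x, y} \<in> E \<and> x \<notin> T \<and> y \<notin> T \<and> c x \<noteq> c y}"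

lemma bichromatic_iff:
  "{x, y} \<in> bichromatic E T c \<longleftrightarrow> {x, y} \<in> E \<and> x \<notin> T \<and> y \<notin> T \<and> c x \<noteq> c y"
  (is "?L \<longleftrightarrow> ?R")
proof
  assume ?L
  then obtain a b where "{x, y} = {a, b}" "{a, b} \<in> E" "a \<notin> T" "b \<notin> T" "c a \<noteq> c b"
    unfolding bichromatic_def by blast
  then show ?R by (auto simp: doubleton_eq_iff insert_commute)
next
  assume ?R
  then show ?L unfolding bichromatic_def by blast
qed

lemma bichromaticE:
  assumes "e \<in> bichromatic E T c"
  obtains x y where "e = {x, y}" "{x, y} \<in> E" "x \<notin> T" "y \<notin> T" "c x \<noteq> c y"
  using assms unfolding bichromatic_def by blast

lemma finite_bichromatic: "finite E \<Longrightarrow> finite (bichromatic E T c)"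
  by (rule finite_subset[of _ E]) (auto elim: bichromaticE)

lemma bichromatic_coarsen:
  assumes "\<And>x y. c x = c y \<Longrightarrow> c' x = c' y"
  shows "bichromatic E T c' \<subseteq> bichromatic E T c"
proof
  fix e assume "e \<in> bichromatic E T c'"
  then obtain x y where e: "e = {x, y}" "{x, y} \<in> E" "x \<notin> T" "y \<notin> T" "c' x \<noteq> c' y"
    by (rule bichromaticE)
  then have "c x \<noteq> c y" using assms by blast
  then show "e \<in> bichromatic E T c" using e by (simp add: bichromatic_iff)
qed

text \<open>Restoring a bichromatic edge merges two colour classes, and restoring a deleted vertex merges at
  most two, because its row and its column are each monochromatic when no bichromatic edge is left.\<close>

lemma arr_multiway_cut:
  fixes c :: "nat \<times> nat \<Rightarrow> 'c"
  assumes n: "n \<ge> 3" and "T \<subseteq> arr_verts n" and "card (c ` (arr_verts n - T)) \<ge> 2"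
  shows "2 * n + card (c ` (arr_verts n - T)) \<le> card T + card (bichromatic (arr_edges n) T c) + 6"
  using assms(2,3)
proof (induction "card (c ` (arr_verts n - T))" arbitrary: c T rule: less_induct)
  case less
  let ?V = "arr_verts n" and ?E = "arr_edges n"
  let ?Y = "?V - T"
  let ?cross = "bichromatic ?E"
  have finT: "finite T" using less.prems(1) finite_arr_verts finite_subset by blast
  have finc: "finite (c ` ?Y)" using finite_arr_verts by simp
  have finX: "finite (?cross T' c')" for T' and c' :: "nat \<times> nat \<Rightarrow> 'c"
    by (rule finite_bichromatic[OF finite_arr_edges])
  show ?case
  proof (cases "card (c ` ?Y) = 2")
    case True
    then obtain \<alpha> \<beta> where ab: "c ` ?Y = {\<alpha>, \<beta>}" "\<alpha> \<noteq> \<beta>" by (meson card_2_iff)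
    \<comment> \<open>With two classes the claim is the bound for a cut into two parts.\<close>
    let ?A = "{x \<in> ?Y. c x = \<alpha>}" and ?B = "{x \<in> ?Y. c x = \<beta>}"
    have "\<alpha> \<in> c ` ?Y" "\<beta> \<in> c ` ?Y" unfolding ab(1) by simp_all
    then have ne: "?A \<noteq> {}" "?B \<noteq> {}" by auto
    have AB: "?A \<subseteq> ?V" "?B \<subseteq> ?V" "?A \<inter> ?B = {}" using ab(2) by auto
    have "?Y \<subseteq> ?A \<union> ?B" using ab(1) by blast
    then have T: "?V - (?A \<union> ?B) = T" using less.prems(1) by auto
    have "{e \<in> ?E. e \<inter> ?A \<noteq> {} \<and> e \<inter> ?B \<noteq> {}} \<subseteq> ?cross T c"
    proof
      fix e assume "e \<in> {e \<in> ?E. e \<inter> ?A \<noteq> {} \<and> e \<inter> ?B \<noteq> {}}"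
      then obtain x y where e: "e \<in> ?E" "x \<in> e" "x \<notin> T" "y \<in> e" "y \<notin> T"
        and c: "c x = \<alpha>" "c y = \<beta>" by auto
      then have ne: "c x \<noteq> c y" using ab(2) by simp
      then have "x \<noteq> y" by blast
      then have "e = {x, y}" by (rule arr_edge_eq[OF e(1,2,4)])
      then show "e \<in> ?cross T c" using e(1,3,5) ne by (simp add: bichromatic_iff)
    qed
    then have "card {e \<in> ?E. e \<inter> ?A \<noteq> {} \<and> e \<inter> ?B \<noteq> {}} \<le> card (?cross T c)"
      by (rule card_mono[OF finX])
    then show ?thesis using arr_mixed_cut[OF AB ne] True unfolding T by linarith
  next
    case False
    then have q: "card (c ` ?Y) \<ge> 3" using less.prems(2) by simp
    \<comment> \<open>The constant is 7 instead of 6 to make up for the lost class.\<close>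
    have IH: "2 * n + card (c ` ?Y) \<le> card T' + card (?cross T' c') + 7"
      if "T' \<subseteq> ?V" and eq: "card (c' ` (?V - T')) = card (c ` ?Y) - 1"
      for T' and c' :: "nat \<times> nat \<Rightarrow> 'c"
    proof -
      have "card (c' ` (?V - T')) < card (c ` ?Y)" "2 \<le> card (c' ` (?V - T'))"
        unfolding eq using q by linarith+
      from less.hyps[OF this(1) that(1) this(2)] show ?thesis unfolding eq using q by linarith
    qed
    define merge where "merge \<alpha> \<beta> z = (if c z = \<beta> then \<alpha> else c z)" for \<alpha> \<beta> z
    have card_merge: "card (merge \<alpha> \<beta> ` ?Y) = card (c ` ?Y) - 1"
      and merge_image: "merge \<alpha> \<beta> ` ?Y = c ` ?Y - {\<beta>}"
      if ab: "\<alpha> \<in> c ` ?Y" "\<beta> \<in> c ` ?Y" "\<alpha> \<noteq> \<beta>" for \<alpha> \<beta>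
    proof -
      show "merge \<alpha> \<beta> ` ?Y = c ` ?Y - {\<beta>}"
      proof
        show "merge \<alpha> \<beta> ` ?Y \<subseteq> c ` ?Y - {\<beta>}" using ab(1,3) by (auto simp: merge_def)
        show "c ` ?Y - {\<beta>} \<subseteq> merge \<alpha> \<beta> ` ?Y"
        proof
          fix \<gamma> assume "\<gamma> \<in> c ` ?Y - {\<beta>}"
          then obtain z where "z \<in> ?Y" "merge \<alpha> \<beta> z = \<gamma>" by (auto simp: merge_def)
          then show "\<gamma> \<in> merge \<alpha> \<beta> ` ?Y" by blast
        qed
      qed
      then show "card (merge \<alpha> \<beta> ` ?Y) = card (c ` ?Y) - 1" using ab(2) finc by simp
    qed
    have coarsen: "?cross T (merge \<alpha> \<beta>) \<subseteq> ?cross T c" for \<alpha> \<beta>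
      by (rule bichromatic_coarsen) (simp add: merge_def)
    show ?thesis
    proof (cases "?cross T c = {}")
      case False
      then obtain e where eX: "e \<in> ?cross T c" by blast
      then obtain x y where e: "e = {x, y}" "{x, y} \<in> ?E" "x \<notin> T" "y \<notin> T" "c x \<noteq> c y"
        by (rule bichromaticE)
      \<comment> \<open>Merging the colours at the ends of \<open>e\<close> makes \<open>e\<close>
        monochromatic, which pays for the lost class.\<close>
      let ?c = "merge (c x) (c y)"
      have "x \<in> ?Y" "y \<in> ?Y" using e arr_edgeD[OF e(2)] by simp_all
      then have "card (?c ` ?Y) = card (c ` ?Y) - 1" using e(5) by (intro card_merge) auto
      then have "2 * n + card (c ` ?Y) \<le> card T + card (?cross T ?c) + 7"
        by (rule IH[OF less.prems(1)])
      moreover have "e \<notin> ?cross T ?c" unfolding e(1) bichromatic_iff by (simp add: merge_def)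
      then have "?cross T ?c \<subset> ?cross T c" using coarsen eX by blast
      then have "card (?cross T ?c) < card (?cross T c)" by (rule psubset_card_mono[OF finX])
      ultimately show ?thesis by linarith
    next
      case True
      have mono: "c x = c y" if "{x, y} \<in> ?E" "x \<notin> T" "y \<notin> T" for x y
      proof (rule ccontr)
        assume "c x \<noteq> c y"
        then have "{x, y} \<in> ?cross T c" using that by (simp add: bichromatic_iff)
        then show False unfolding True by simp
      qed
      show ?thesis
      proof (cases "T = {}")
        case T: True
        have "\<not> card (c ` ?Y) \<le> Suc 0" using q by simp
        then obtain \<alpha> \<beta> where "\<alpha> \<in> c ` ?Y" "\<beta> \<in> c ` ?Y" "\<alpha> \<noteq> \<beta>"
          unfolding card_le_Suc0_iff_eq[OF finc] by blast
        then have "card (merge \<alpha> \<beta> ` ?Y) = card (c ` ?Y) - 1" by (rule card_merge)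
        \<comment> \<open>With \<open>n \<ge> 3\<close> and at least three classes the left side is
          at least 9, but the right side is 7 since nothing is deleted.\<close>
        then have "2 * n + card (c ` ?Y) \<le> card T + card (?cross T (merge \<alpha> \<beta>)) + 7"
          by (rule IH[OF less.prems(1)])
        moreover have "?cross T (merge \<alpha> \<beta>) = {}" using coarsen unfolding True by blast
        then have "card (?cross T (merge \<alpha> \<beta>)) = 0" by (simp only: card.empty)
        moreover have "card T = 0" using T by simp
        ultimately show ?thesis using n q by linarith
      next
        case False
        then obtain t where t: "t \<in> T" by blast
        \<comment> \<open>The colours seen from \<open>t\<close> along its row or its column: each
          line is a clique, hence shows at most one.\<close>
        let ?N = "\<lambda>f. c ` {x \<in> ?Y. f x = f t}"
        have line: "card (?N f) \<le> 1" if f: "f = fst \<or> f = snd" for f :: "nat \<times> nat \<Rightarrow> nat"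
        proof -
          have "c x = c y" if xy: "x \<in> ?Y" "f x = f t" "y \<in> ?Y" "f y = f t" for x y
          proof (cases "x = y")
            case False
            then have "{x, y} \<in> ?E" using xy f by (intro arr_edgeI) auto
            then show ?thesis using xy by (intro mono) simp_all
          qed simp
          then have "\<forall>\<alpha>\<in>?N f. \<forall>\<beta>\<in>?N f. \<alpha> = \<beta>" by blast
          moreover have "finite (?N f)" using finite_arr_verts by simp
          ultimately have "card (?N f) \<le> Suc 0" by (simp only: card_le_Suc0_iff_eq)
          then show ?thesis by simp
        qed
        have "card (?N fst \<union> ?N snd) \<le> 2"
          using card_Un_le[of "?N fst" "?N snd"] line[of fst] line[of snd] by simp
        moreover have "?N fst \<union> ?N snd \<subseteq> c ` ?Y" by blast
        \<comment> \<open>The colours around \<open>t\<close> are padded to exactly two, so that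
          restoring \<open>t\<close> lowers the number of classes by exactly one.\<close>
        ultimately obtain W where W: "?N fst \<union> ?N snd \<subseteq> W" "W \<subseteq> c ` ?Y" "card W = 2"
          using exists_subset_between[of "?N fst \<union> ?N snd" 2 "c ` ?Y"] less.prems(2) finc by blast
        then obtain \<alpha> \<beta> where W_eq: "W = {\<alpha>, \<beta>}" and ne: "\<alpha> \<noteq> \<beta>" by (meson card_2_iff)
        have ab: "\<alpha> \<in> c ` ?Y" "\<beta> \<in> c ` ?Y" using W(2) unfolding W_eq by simp_all
        have nbr: "c x = \<alpha> \<or> c x = \<beta>" if tx: "{t, x} \<in> ?E" "x \<notin> T" for x
        proof -
          have "x \<in> ?Y" "fst x = fst t \<or> snd x = snd t" using tx unfolding arr_edge_iff by auto
          then have "c x \<in> ?N fst \<union> ?N snd" by blast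
          then show ?thesis using W(1) unfolding W_eq by blast
        qed
        let ?T = "T - {t}"
        \<comment> \<open>\<open>t\<close> and its remaining neighbours all get the colour
          \<open>\<alpha>\<close>, so restoring \<open>t\<close> creates no bichromatic
          edge.\<close>
        define c' where "c' = (merge \<alpha> \<beta>)(t := \<alpha>)"
        have "?V - ?T = insert t ?Y" using t less.prems(1) by auto
        then have "c' ` (?V - ?T) = insert \<alpha> (merge \<alpha> \<beta> ` ?Y)" using t by (auto simp: c'_def)
        also have "\<dots> = merge \<alpha> \<beta> ` ?Y" unfolding merge_image[OF ab ne] using ab ne by blast
        finally have "card (c' ` (?V - ?T)) = card (c ` ?Y) - 1" by (simp only: card_merge[OF ab ne])
        moreover have "?T \<subseteq> ?V" using less.prems(1) by blast
        ultimately have "2 * n + card (c ` ?Y) \<le> card ?T + card (?cross ?T c') + 7" by (intro IH)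
        moreover have "?cross ?T c' = {}"
        proof (rule equals0I)
          fix e assume "e \<in> ?cross ?T c'"
          then obtain x y where e: "{x, y} \<in> ?E" "x \<notin> ?T" "y \<notin> ?T" "c' x \<noteq> c' y"
            by (rule bichromaticE)
          have t_nbr: "c' z = \<alpha>" if "{t, z} \<in> ?E" "z \<notin> ?T" for z
            using nbr[OF that(1)] that(2) by (auto simp: c'_def merge_def)
          have "{y, x} \<in> ?E" using e(1) by (simp add: insert_commute)
          then have "x \<noteq> t" "y \<noteq> t"
            using e t_nbr[of x] t_nbr[of y] by (auto simp: c'_def)
          then show False using mono[OF e(1)] e(2-4) by (auto simp: c'_def merge_def split: if_splits)
        qed
        then have "card (?cross ?T c') = 0" by (simp only: card.empty)
        moreover have "Suc (card ?T) = card T" by (rule card_Suc_Diff1[OF finT t])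
        ultimately show ?thesis by linarith
      qed
    qed
  qed
qed

section \<open>The preclusion number\<close>

text \<open>\<open>FV \<union> S\<close> and \<open>FE\<close> form a multiway cut. With
  \<open>card S + 2\<close> or more colours the cut bound would give
  \<open>2 * n + card S + 2 \<le> card FV + card S + card FE + 6\<close>, that is, at least
  \<open>2 * n - 4\<close> faults.\<close>

lemma few_colours:
  assumes n: "n \<ge> 3" and F: "FV \<subseteq> arr_verts n" "FE \<subseteq> arr_edges n" "card FV + card FE < 2 * n - 4"
    and S: "S \<subseteq> arr_verts n - FV"
    and c: "\<And>x y. {x, y} \<in> del_edges (arr_edges n) FV FE \<Longrightarrow> x \<notin> S \<Longrightarrow> y \<notin> S \<Longrightarrow> c x = c y"
  shows "card (c ` (arr_verts n - FV - S)) \<le> card S + 1"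
proof (rule ccontr)
  assume "\<not> ?thesis"
  then have q: "card (c ` (arr_verts n - FV - S)) \<ge> card S + 2" by simp
  let ?T = "FV \<union> S"
  have Y: "arr_verts n - ?T = arr_verts n - FV - S" by blast
  have "?T \<subseteq> arr_verts n" using F(1) S by blast
  moreover have "2 \<le> card (c ` (arr_verts n - ?T))" unfolding Y using q by simp
  ultimately have "2 * n + card (c ` (arr_verts n - ?T))
      \<le> card ?T + card (bichromatic (arr_edges n) ?T c) + 6"
    by (rule arr_multiway_cut[OF n])
  moreover have "card ?T \<le> card FV + card S" by (rule card_Un_le)
  moreover have "bichromatic (arr_edges n) ?T c \<subseteq> FE"
  proof
    fix e assume "e \<in> bichromatic (arr_edges n) ?T c"
    then obtain x y where e: "e = {x, y}" "{x, y} \<in> arr_edges n" "x \<notin> ?T" "y \<notin> ?T" "c x \<noteq> c y"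
      by (rule bichromaticE)
    then have "{x, y} \<notin> del_edges (arr_edges n) FV FE" using c[of x y] by blast
    then show "e \<in> FE" using e(1-4) unfolding del_edges_def by simp
  qed
  then have "card (bichromatic (arr_edges n) ?T c) \<le> card FE"
    by (rule card_mono[OF finite_subset[OF F(2) finite_arr_edges]])
  ultimately show False using q F(3) unfolding Y by simp
qed

text \<open>One representative is taken in each row that meets \<open>D\<close>. Every other vertex
  of \<open>D\<close> is joined to the representative of its row by an edge of \<open>FE\<close>,
  and different vertices use different edges.\<close>

lemma card_arr_independent:
  assumes D: "D \<subseteq> arr_verts n" and FE: "finite FE"
    and indep: "\<And>x y. x \<in> D \<Longrightarrow> y \<in> D \<Longrightarrow> {x, y} \<in> arr_edges n \<Longrightarrow> {x, y} \<in> FE"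
  shows "card D \<le> n + card FE"
proof -
  have finD: "finite D" using D finite_arr_verts finite_subset by blast
  define r where "r i = (SOME d. d \<in> D \<and> fst d = i)" for i
  have r: "r (fst d) \<in> D" "fst (r (fst d)) = fst d" if "d \<in> D" for d
    using someI[of "\<lambda>d'. d' \<in> D \<and> fst d' = fst d" d] that unfolding r_def by auto
  let ?R = "r ` fst ` D"
  have "fst ` D \<subseteq> {1..n}" using D unfolding arr_verts_def by auto
  then have "card (fst ` D) \<le> n" using card_mono[of "{1..n}"] by fastforce
  then have R: "card ?R \<le> n" using card_image_le[of "fst ` D" r] finD by simp
  have "card (D - ?R) \<le> card FE"
  proof (rule card_inj_on_le[OF _ _ FE])
    show "inj_on (\<lambda>d. {d, r (fst d)}) (D - ?R)"
      by (rule inj_onI) (auto simp: doubleton_eq_iff)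
    show "(\<lambda>d. {d, r (fst d)}) ` (D - ?R) \<subseteq> FE"
    proof clarify
      fix d assume d: "d \<in> D" "d \<notin> ?R"
      then have "d \<noteq> r (fst d)" by blast
      then have "{d, r (fst d)} \<in> arr_edges n"
        using r[OF d(1)] d(1) D by (intro arr_edgeI) auto
      then show "{d, r (fst d)} \<in> FE" using r[OF d(1)] d(1) by (intro indep)
    qed
  qed
  moreover have "card D \<le> card ?R + card (D - ?R)"
    using card_Un_le[of ?R "D - ?R"] card_mono[of "?R \<union> (D - ?R)" D] finD by fastforce
  ultimately show ?thesis using R by simp
qed

lemma ex_matching_few_faults:
  assumes "odd k" and n: "n \<ge> 5"
    and F: "FV \<subseteq> arr_verts n" "FE \<subseteq> arr_edges n" "card FV + card FE < 2 * n - 4"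
  shows "(\<exists>h. perfect_int_matching k (arr_verts n - FV) (del_edges (arr_edges n) FV FE) h) \<or>
    (\<exists>h. almost_perfect_int_matching k (arr_verts n - FV) (del_edges (arr_edges n) FV FE) h)"
proof -
  let ?X = "arr_verts n - FV" and ?E = "del_edges (arr_edges n) FV FE"
  have n3: "n \<ge> 3" using n by simp
  have G: "fin_graph ?X ?E"
    using fin_graph_arr[of n] unfolding fin_graph_def del_edges_def by blast
  interpret fin_graph ?X ?E by (rule G)
  note few = few_colours[OF n3 F]
  obtain M where M: "max_matching ?E M" using ex_max_matching by blast
  then have mM: "matching ?E M" unfolding max_matching_def by blast
  obtain S and c :: "nat \<times> nat \<Rightarrow> (nat \<times> nat) set" where S: "S \<subseteq> ?X"
    and c: "\<And>x y. {x, y} \<in> ?E \<Longrightarrow> x \<notin> S \<Longrightarrow> y \<notin> S \<Longrightarrow> c x = c y"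
    and le: "card ?X + card S \<le> card (c ` (?X - S)) + 2 * card M"
    using Tutte_Berge_barrier[OF G M] by blast
  \<comment> \<open>The barrier bounds the number of missed vertices by the number of colours minus
    \<open>card S\<close>.\<close>
  have "card (?X - \<Union>M) \<le> 1" using few[OF S, of c] c le card_missed[OF mM] by simp
  then consider "card (?X - \<Union>M) = 0" | "card (?X - \<Union>M) = 1" by linarith
  then show ?thesis
  proof cases
    case 1
    then have "\<Union>M = ?X" using Union_matching[OF mM] fin by auto
    then show ?thesis using perfect_int_matching_if_perfect[OF mM] by blast
  next
    case 2
    then obtain u where u: "?X - \<Union>M = {u}" by (auto simp: card_1_singleton_iff)
    then have uX: "u \<in> ?X" and Mu: "\<Union>M = ?X - {u}" using Union_matching[OF mM] by auto
    show ?thesis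
    proof (rule ccontr)
      assume "\<not> ?thesis"
      \<comment> \<open>Adjacent vertices missed by near-perfect matchings would yield an almost
        perfect integer matching.\<close>
      then have "\<exists>D A. D \<union> A \<subseteq> ?X \<and> D \<inter> A = {} \<and> card D = card A + 1
          \<and> (\<forall>x y. {x, y} \<in> ?E \<and> x \<in> D \<longrightarrow> y \<in> A)"
        using almost_perfect_int_matching_if_near_perfect[OF \<open>odd k\<close>]
        by (intro alternating_tree[OF G mM Mu uX]) blast
      then obtain D A where DA: "D \<union> A \<subseteq> ?X" "D \<inter> A = {}" "card D = card A + 1"
        and N: "\<And>x y. {x, y} \<in> ?E \<Longrightarrow> x \<in> D \<Longrightarrow> y \<in> A" by blast
      have finDA: "finite D" "finite A" using finite_subset[OF DA(1) fin] by simp_all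
      show False
      proof (cases "?X = D \<union> A")
        case False
        then obtain w where w: "w \<in> ?X" "w \<notin> D" "w \<notin> A" using DA(1) by blast
        \<comment> \<open>Outer vertices have neighbours in \<open>A\<close> only, so each may form
          a colour class of its own. With the class of \<open>w\<close> this makes
          \<open>card A + 2\<close> colours.\<close>
        define g where "g x = (if x \<in> D then x else w)" for x
        have "g x = g y" if xy: "{x, y} \<in> ?E" "x \<notin> A" "y \<notin> A" for x y
        proof -
          have "{y, x} \<in> ?E" using xy(1) by (simp add: insert_commute)
          then show ?thesis using N[OF xy(1)] N[of y x] xy(2,3) unfolding g_def by auto
        qed
        then have "card (g ` (?X - A)) \<le> card A + 1" using DA(1) by (intro few) auto
        moreover have "insert w D \<subseteq> g ` (?X - A)"
        proof
          fix x assume "x \<in> insert w D"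
          then have "x = g x" "x \<in> ?X - A" using DA w unfolding g_def by auto
          then show "x \<in> g ` (?X - A)" by (rule image_eqI)
        qed
        then have "card (insert w D) \<le> card (g ` (?X - A))" using fin by (intro card_mono) auto
        ultimately show False using w finDA DA(3) by simp
      next
        case True
        \<comment> \<open>The tree spans the graph, so \<open>D\<close> has more than half of the
          vertices, yet all edges of the arrangement graph inside \<open>D\<close> are
          faulty.\<close>
        have "card D \<le> n + card FE"
        proof (rule card_arr_independent)
          show "D \<subseteq> arr_verts n" using DA(1) by blast
          show "finite FE" using F(2) finite_arr_edges finite_subset by blast
          fix x y assume xy: "x \<in> D" "y \<in> D" "{x, y} \<in> arr_edges n"
          then have "{x, y} \<notin> ?E" using N[of x y] DA(2) by blast
          then show "{x, y} \<in> FE" using xy DA(1) unfolding del_edges_def by auto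
        qed
        moreover have "card ?X = card D + card A"
          unfolding True using finDA DA(2) by (rule card_Un_disjoint)
        moreover have "card ?X = n * (n - 1) - card FV"
          using F(1) finite_arr_verts by (simp add: card_Diff_subset finite_subset card_arr_verts)
        \<comment> \<open>From \<open>card ?X = 2 * card D - 1\<close> and at most
          \<open>2 * n - 5\<close> faults. The inequality fails already at \<open>n = 5\<close>,
          where it reads 32 \<le> 31.\<close>
        ultimately have le: "n * (n - 1) + 12 \<le> 6 * n + 1" using F(3) DA(3) by simp
        obtain m where "n = m + 5" using n by (metis le_add_diff_inverse2)
        with le show False by (simp add: algebra_simps)
      qed
    qed
  qed
qed

theorem theorem3p15:
  fixes k n :: nat
  assumes "odd k" and "k \<ge> 3" and "n \<ge> 5"
  shows "smp k (arr_verts n) (arr_edges n) = 2 * n - 4"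
  unfolding smp_def
proof (rule Least_equality)
  \<comment> \<open>Deleting all neighbours of one vertex isolates it.\<close>
  let ?v = "(1, 2) :: nat \<times> nat"
  let ?N = "{w. {?v, w} \<in> arr_edges n}"
  let ?X = "arr_verts n - ?N" and ?E = "del_edges (arr_edges n) ?N {}"
  have v: "?v \<in> arr_verts n" using assms(3) by (simp add: arr_verts_iff)
  have X: "?v \<in> ?X" using v by (simp add: arr_edge_iff)
  have "incident ?E ?v = {}"
  proof -
    have False if e: "e \<in> arr_edges n" "?v \<in> e" "e \<inter> ?N = {}" for e
    proof -
      obtain w where "e = {?v, w}" using fin_graph.edge_other[OF fin_graph_arr e(1,2)] by metis
      then show False using e by auto
    qed
    then show ?thesis unfolding incident_def del_edges_def by blast
  qed
  \<comment> \<open>The isolated vertex has sum 0, but \<open>k\<close> or \<open>k - 1\<close>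
    would be required, and both are positive.\<close>
  then have sum: "(\<Sum>e\<in>incident ?E ?v. h e) = 0" for h :: "(nat \<times> nat) set \<Rightarrow> nat" by simp
  have "\<not> perfect_int_matching k ?X ?E h" for h
  proof
    assume "perfect_int_matching k ?X ?E h"
    then have "(\<Sum>e\<in>incident ?E ?v. h e) = k"
      using X unfolding perfect_int_matching_def by (elim conjE bspec)
    then show False using sum[of h] assms(2) by simp
  qed
  moreover have "\<not> almost_perfect_int_matching k ?X ?E h" for h
  proof
    assume "almost_perfect_int_matching k ?X ?E h"
    then obtain u where u: "(\<Sum>e\<in>incident ?E u. h e) = k - 1"
      "\<forall>v\<in>?X - {u}. (\<Sum>e\<in>incident ?E v. h e) = k"
      unfolding almost_perfect_int_matching_def by (elim conjE bexE)
    show False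
    proof (cases "?v = u")
      case True then show False using u(1) sum[of h] assms(2) by simp
    next
      case False
      then have "(\<Sum>e\<in>incident ?E ?v. h e) = k" using X by (intro bspec[OF u(2)]) simp
      then show False using sum[of h] assms(2) by simp
    qed
  qed
  moreover have "?N \<subseteq> arr_verts n" by (auto simp: arr_edge_iff)
  ultimately show "\<exists>FV FE. FV \<subseteq> arr_verts n \<and> FE \<subseteq> arr_edges n \<and> 2 * n - 4 = card FV + card FE \<and>
      \<not> (\<exists>h. perfect_int_matching k (arr_verts n - FV) (del_edges (arr_edges n) FV FE) h) \<and>
      \<not> (\<exists>h. almost_perfect_int_matching k (arr_verts n - FV) (del_edges (arr_edges n) FV FE) h)"
    using card_arr_nbrs[OF v] by (intro exI[of _ ?N] exI[of _ "{}"]) simp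
next
  fix m
  assume "\<exists>FV FE. FV \<subseteq> arr_verts n \<and> FE \<subseteq> arr_edges n \<and> m = card FV + card FE \<and>
      \<not> (\<exists>h. perfect_int_matching k (arr_verts n - FV) (del_edges (arr_edges n) FV FE) h) \<and>
      \<not> (\<exists>h. almost_perfect_int_matching k (arr_verts n - FV) (del_edges (arr_edges n) FV FE) h)"
  then obtain FV FE where F: "FV \<subseteq> arr_verts n" "FE \<subseteq> arr_edges n" "m = card FV + card FE"
    and none: "\<not> (\<exists>h. perfect_int_matching k (arr_verts n - FV) (del_edges (arr_edges n) FV FE) h)"
      "\<not> (\<exists>h. almost_perfect_int_matching k (arr_verts n - FV) (del_edges (arr_edges n) FV FE) h)"
    by (elim exE conjE)
  then show "2 * n - 4 \<le> m"
    using ex_matching_few_faults[OF assms(1,3) F(1,2)] by (metis not_le)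
qed

end
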